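(* Let $d \ge 1$, and let $P, P_1, P_2, P_3, \ldots$ be probability measures in $\mathcal{P}_d^{(\mathrm{lc})}$ with densities $f, f_1, f_2, f_3, \ldots$, respectively, such that $P_n \to P$ weakly as $n \to \infty$. Then the following two conclusions hold true: (i) The sequence $(f_n)_n$ converges uniformly to $f$ on any closed set of continuity points of $f$ (i.e. on every closed set $S \subset \mathbb{R}^d$ such that the function $f : \mathbb{R}^d \to [0,\infty)$ is continuous at each point of $S$). (ii) Let $A : \mathbb{R}^d \to \mathbb{R}$ be a sublinear function, i.e. $A(x+y) \le A(x) + A(y)$ and $A(rx) = rA(x)$ for all $x, y \in \mathbb{R}^d$ and $r \ge 0$. If $$f(x)\exp(A(x)) \to 0 \quad\text{as } \|x\| \to \infty,$$ then $\int_{\mathbb{R}^d} \exp(A(x)) f(x)\, dx < \infty$ and $$\lim_{n\to\infty} \int_{\mathbb{R}^d} \exp(A(x)) \, |f_n(x) - f(x)| \, dx = 0.$$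
   Context: $\mathcal{P}_d^{(\mathrm{lc})}$ denotes the set of all log-concave probability distributions on $\mathbb{R}^d$, i.e. all probability measures admitting a Lebesgue density of the form $f(x) = \exp(\varphi(x))$ for some concave function $\varphi : \mathbb{R}^d \to [-\infty,\infty)$ (with $\exp(-\infty) = 0$). "The density" of such a measure always means a density of this form. $\|\cdot\|$ is the Euclidean norm. *)

theory Defs
  imports "HOL-Probability.Probability"
begin

text \<open>The values are required to lie in \<open>[-\<infinity>, \<infinity>)\<close>; in particular the sum on the left-hand side
  never has the form \<open>\<infinity> - \<infinity>\<close>. For \<open>u = 0\<close> or \<open>v = 0\<close> the inequality is trivial, since
  \<open>0 * (-\<infinity>) = 0\<close> in \<^typ>\<open>ereal\<close>.\<close>

definition ereal_concave :: "('a::real_vector \<Rightarrow> ereal) \<Rightarrow> bool" where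
  "ereal_concave \<phi> \<longleftrightarrow> (\<forall>x. \<phi> x < \<infinity>) \<and>
     (\<forall>x y u v. 0 \<le> u \<longrightarrow> 0 \<le> v \<longrightarrow> u + v = 1 \<longrightarrow>
        ereal u * \<phi> x + ereal v * \<phi> y \<le> \<phi> (u *\<^sub>R x + v *\<^sub>R y))"

text \<open>Only used for arguments in \<open>[-\<infinity>, \<infinity>)\<close>.\<close>

definition exp_ereal :: "ereal \<Rightarrow> real" where
  "exp_ereal x = (if x = -\<infinity> then 0 else exp (real_of_ereal x))"

definition log_concave_fun :: "('a::real_vector \<Rightarrow> real) \<Rightarrow> bool" where
  "log_concave_fun f \<longleftrightarrow> (\<exists>\<phi>. ereal_concave \<phi> \<and> (\<forall>x. f x = exp_ereal (\<phi> x)))"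

text \<open>Probability measures live on the Borel sets, whereas a log-concave function is in general only
  Lebesgue measurable (its values on the boundary of its support are largely arbitrary). Hence
  densities are taken with respect to \<^term>\<open>lebesgue\<close>, and the density identity is stated for
  Borel sets.\<close>

definition lebesgue_density :: "'a::euclidean_space measure \<Rightarrow> ('a \<Rightarrow> real) \<Rightarrow> bool" where
  "lebesgue_density P f \<longleftrightarrow> f \<in> borel_measurable lebesgue \<and> (\<forall>x. 0 \<le> f x) \<and>
     (\<forall>B\<in>sets borel. emeasure P B = (\<integral>\<^sup>+x\<in>B. ennreal (f x) \<partial>lebesgue))"

definition lc_density :: "'a::euclidean_space measure \<Rightarrow> ('a \<Rightarrow> real) \<Rightarrow> bool" where
  "lc_density P f \<longleftrightarrow> lebesgue_density P f \<and> log_concave_fun f"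

definition lc_distributions :: "'a::euclidean_space measure set" where
  "lc_distributions = {P. prob_space P \<and> sets P = sets borel \<and> (\<exists>f. lc_density P f)}"

text \<open>The library's \<^const>\<open>weak_conv_m\<close> is restricted to measures on the real line.\<close>

definition weakly_converges ::
  "(nat \<Rightarrow> 'a::topological_space measure) \<Rightarrow> 'a measure \<Rightarrow> bool" where
  "weakly_converges Pn P \<longleftrightarrow>
     (\<forall>g :: 'a \<Rightarrow> real. continuous_on UNIV g \<longrightarrow> bounded (range g) \<longrightarrow>
        (\<lambda>n. \<integral>x. g x \<partial>Pn n) \<longlonglongrightarrow> (\<integral>x. g x \<partial>P))"

definition sublinear :: "('a::real_vector \<Rightarrow> real) \<Rightarrow> bool" where
  "sublinear A \<longleftrightarrow> (\<forall>x y. A (x + y) \<le> A x + A y) \<and> (\<forall>x r. 0 \<le> r \<longrightarrow> A (r *\<^sub>R x) = r * A x)"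

end

theory Submission
  imports Defs
begin

text \<open>Testing weak convergence against tent functions shows that \<open>fn n\<close> cannot stay strictly below
  (or above) \<open>f\<close> on a fixed ball. Log-concavity upgrades this to locally uniform bounds: superlevel
  sets are convex, so a single small value is propagated to a half-space by a separating
  hyperplane, and a single large value is propagated to a cone over a fixed ball on which \<open>fn n\<close> is
  bounded below. Hence \<open>fn n\<close> converges to \<open>f\<close> locally uniformly near each continuity point. On a
  large sphere \<open>f exp A\<close> is small, hence so is \<open>fn n exp A\<close>; being log-concave along rays, it
  decays exponentially beyond the sphere, uniformly in \<open>n\<close>. This bound handles unbounded closed
  sets and is the dominating function for the weighted integrals, as \<open>f\<close> is continuous off the
  null boundary of its convex support.\<close>

section \<open>Log-concave functions and test functions\<close>

lemma log_concave_fun_nonneg: "log_concave_fun f \<Longrightarrow> 0 \<le> f x"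
  by (auto simp: log_concave_fun_def exp_ereal_def)

lemma log_concave_funD:
  assumes "log_concave_fun f" "0 \<le> u" "0 \<le> v" "u + v = 1"
  shows "f x powr u * f y powr v \<le> f (u *\<^sub>R x + v *\<^sub>R y)"
proof (cases "f x = 0 \<or> f y = 0")
  \<comment> \<open>\<open>0 powr u = 0\<close> holds for every \<open>u\<close>, even
    \<open>u = 0\<close>, so the left-hand side vanishes.\<close>
  case True
  then show ?thesis
    using log_concave_fun_nonneg[OF assms(1)] by auto
next
  case False
  obtain \<phi> where \<phi>: "ereal_concave \<phi>" "\<And>x. f x = exp_ereal (\<phi> x)"
    using assms(1) by (auto simp: log_concave_fun_def)
  have lt: "\<phi> z < \<infinity>" for z
    using \<phi>(1) by (auto simp: ereal_concave_def)
  obtain a where a: "\<phi> x = ereal a"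
    using False \<phi>(2)[of x] lt[of x] by (cases "\<phi> x") (auto simp: exp_ereal_def)
  obtain b where b: "\<phi> y = ereal b"
    using False \<phi>(2)[of y] lt[of y] by (cases "\<phi> y") (auto simp: exp_ereal_def)
  have "ereal u * \<phi> x + ereal v * \<phi> y \<le> \<phi> (u *\<^sub>R x + v *\<^sub>R y)"
    using \<phi>(1) assms(2-4) by (auto simp: ereal_concave_def)
  then have le: "ereal (u * a + v * b) \<le> \<phi> (u *\<^sub>R x + v *\<^sub>R y)"
    by (simp add: a b)
  then obtain c where c: "\<phi> (u *\<^sub>R x + v *\<^sub>R y) = ereal c"
    using lt[of "u *\<^sub>R x + v *\<^sub>R y"] by (cases "\<phi> (u *\<^sub>R x + v *\<^sub>R y)") auto
  have "f x powr u * f y powr v = exp (u * a + v * b)"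
    by (simp add: \<phi>(2) exp_ereal_def a b powr_def exp_add)
  also have "\<dots> \<le> f (u *\<^sub>R x + v *\<^sub>R y)"
    using le by (simp add: \<phi>(2) exp_ereal_def c)
  finally show ?thesis .
qed

lemma log_concave_fun_ge:
  assumes "log_concave_fun f" "0 \<le> u" "0 \<le> v" "u + v = 1" "0 \<le> a" "0 \<le> b" "a \<le> f x" "b \<le> f y"
  shows "a powr u * b powr v \<le> f (u *\<^sub>R x + v *\<^sub>R y)"
proof -
  have "a powr u * b powr v \<le> f x powr u * f y powr v"
    using assms by (intro mult_mono powr_mono2) auto
  then show ?thesis
    using log_concave_funD[OF assms(1-4), of x y] by linarith
qed

lemma convex_superlevel:
  assumes "log_concave_fun f"
  shows "convex {x. c \<le> f x}" and "convex {x. 0 < f x}"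
proof -
  have ge: "c \<le> f (u *\<^sub>R x + v *\<^sub>R y)"
    if "c \<ge> 0" "0 \<le> u" "0 \<le> v" "u + v = 1" "c \<le> f x" "c \<le> f y" for c x y u v
  proof -
    have "c powr u * c powr v = c"
      using that by (simp flip: powr_add)
    then show ?thesis
      using log_concave_fun_ge[OF assms that(2-4,1,1,5,6)] by simp
  qed
  show "convex {x. c \<le> f x}"
  proof (cases "0 \<le> c")
    case True
    then show ?thesis
      using ge by (auto intro!: convexI)
  next
    case False
    then have "{x. c \<le> f x} = UNIV"
      using log_concave_fun_nonneg[OF assms] by (auto intro: order_trans[of _ 0])
    then show ?thesis by simp
  qed
  show "convex {x. 0 < f x}"
  proof (intro convexI, clarsimp)
    fix x y and u v :: real
    assume *: "0 < f x" "0 < f y" "0 \<le> u" "0 \<le> v" "u + v = 1"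
    \<comment> \<open>Positivity is a strict condition, so the non-strict case is applied at the
      level \<open>min (f x) (f y)\<close>, which is itself positive.\<close>
    have "min (f x) (f y) \<le> f (u *\<^sub>R x + v *\<^sub>R y)"
      using * by (intro ge) auto
    then show "0 < f (u *\<^sub>R x + v *\<^sub>R y)"
      using * by linarith
  qed
qed

text \<open>Sublinearity gives convexity, and a finite convex function on an open subset of a
  Euclidean space is continuous.\<close>

lemma sublinear_continuous:
  fixes A :: "'a::euclidean_space \<Rightarrow> real"
  assumes "sublinear A"
  shows "continuous_on UNIV A"
proof (rule convex_on_continuous)
  show "convex_on UNIV A"
    using assms unfolding convex_on_def sublinear_def by (metis convex_UNIV)
qed simp

text \<open>\<open>P\<close> lives on the Borel sets while \<open>f\<close> is only Lebesgue
  measurable. Pushing the weighted completed measure forward along the identity restricts it to the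
  Borel sets, so the integral rules for \<open>distr\<close> and \<open>density\<close> become
  applicable.\<close>

lemma lebesgue_density_eq_distr:
  assumes "sets P = sets borel" "lebesgue_density P f"
  shows "P = distr (density lebesgue (\<lambda>x. ennreal (f x))) borel (\<lambda>x. x)"
proof (rule measure_eqI)
  have [measurable]: "f \<in> borel_measurable lebesgue"
    using assms(2) by (auto simp: lebesgue_density_def)
  show "sets P = sets (distr (density lebesgue (\<lambda>x. ennreal (f x))) borel (\<lambda>x. x))"
    using assms(1) by simp
  fix B assume "B \<in> sets P"
  then have B: "B \<in> sets borel" "B \<in> sets lebesgue"
    using assms(1) by auto
  have id: "(\<lambda>x. x) \<in> density lebesgue (\<lambda>x. ennreal (f x)) \<rightarrow>\<^sub>M borel"
    by (auto simp: measurable_def)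
  show "emeasure P B = emeasure (distr (density lebesgue (\<lambda>x. ennreal (f x))) borel (\<lambda>x. x)) B"
    using B assms(2)
    by (simp add: emeasure_distr[OF id] emeasure_density lebesgue_density_def)
qed

lemma integral_lebesgue_density:
  fixes g :: "'a::euclidean_space \<Rightarrow> real"
  assumes "sets P = sets borel" "lebesgue_density P f" "g \<in> borel_measurable borel"
  shows "(\<integral>x. g x \<partial>P) = (\<integral>x. f x * g x \<partial>lebesgue)"
    and "integrable P g \<longleftrightarrow> integrable lebesgue (\<lambda>x. f x * g x)"
proof -
  have f: "f \<in> borel_measurable lebesgue" "AE x in lebesgue. 0 \<le> f x"
    using assms(2) by (auto simp: lebesgue_density_def)
  have g: "g \<in> borel_measurable lebesgue"
    using assms(3) by (simp add: measurable_completion)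
  have id: "(\<lambda>x. x) \<in> density lebesgue (\<lambda>x. ennreal (f x)) \<rightarrow>\<^sub>M borel"
    by (auto simp: measurable_def)
  have P: "P = distr (density lebesgue (\<lambda>x. ennreal (f x))) borel (\<lambda>x. x)"
    using assms by (intro lebesgue_density_eq_distr)
  show "(\<integral>x. g x \<partial>P) = (\<integral>x. f x * g x \<partial>lebesgue)"
    by (subst P, subst integral_distr[OF id assms(3)], subst integral_density[OF g f]) simp
  show "integrable P g \<longleftrightarrow> integrable lebesgue (\<lambda>x. f x * g x)"
    by (subst P, subst integrable_distr_eq[OF id assms(3)], subst integrable_density[OF g f]) simp
qed

text \<open>A bounded continuous substitute for the indicator of \<open>ball z r\<close>, hence an
  admissible test function for weak convergence.\<close>

definition tent :: "'a::euclidean_space \<Rightarrow> real \<Rightarrow> 'a \<Rightarrow> real" where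
  "tent z r x = max 0 (r - dist z x)"

lemma tent_nonneg: "0 \<le> tent z r x"
  by (simp add: tent_def)

lemma tent_le: "tent z r x \<le> \<bar>r\<bar>"
proof -
  have "0 \<le> dist z x" by simp
  then show ?thesis
    unfolding tent_def by linarith
qed

lemma tent_outside: "x \<notin> ball z r \<Longrightarrow> tent z r x = 0"
  by (simp add: tent_def)

lemma continuous_on_tent: "continuous_on UNIV (tent z r)"
  unfolding tent_def by (intro continuous_intros)

lemma measurable_tent [measurable]: "tent z r \<in> borel_measurable borel"
  by (intro borel_measurable_continuous_onI continuous_on_tent)

lemma bounded_tent: "bounded (range (tent z r))"
  unfolding bounded_iff using tent_le[of z r] tent_nonneg[of z r] by (auto intro!: exI[of _ "\<bar>r\<bar>"])

lemma integrable_tent: "integrable lebesgue (tent z r)"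
proof (rule Bochner_Integration.integrable_bound)
  show "integrable lebesgue (\<lambda>x. \<bar>r\<bar> * indicator (ball z r) x)"
    by (intro integrable_mult_right integrable_real_indicator)
       (use emeasure_lborel_ball_finite[of z r] in auto)
  show "tent z r \<in> borel_measurable lebesgue"
    by (simp add: measurable_completion)
  show "AE x in lebesgue. norm (tent z r x) \<le> norm (\<bar>r\<bar> * indicator (ball z r) x)"
    using tent_le[of z r] tent_nonneg[of z r] tent_outside[of _ z r]
    by (intro AE_I2) (auto simp: indicator_def)
qed

lemma integral_tent_pos:
  assumes "0 < r"
  shows "0 < (\<integral>x. tent z r x \<partial>lebesgue)"
proof -
  have "0 < r / 2 * measure lebesgue (ball z (r / 2))"
    using assms by (simp add: content_ball_pos)
  also have "\<dots> = (\<integral>x. r / 2 * indicator (ball z (r / 2)) x \<partial>lebesgue)"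
    by simp
  also have "\<dots> \<le> (\<integral>x. tent z r x \<partial>lebesgue)"
  proof (rule integral_mono)
    show "integrable lebesgue (\<lambda>x. r / 2 * indicator (ball z (r / 2)) x)"
      by (intro integrable_mult_right integrable_real_indicator)
         (use emeasure_lborel_ball_finite[of z "r / 2"] in auto)
    show "r / 2 * indicator (ball z (r / 2)) x \<le> tent z r x" for x
      by (auto simp: indicator_def tent_def max_def)
  qed (rule integrable_tent)
  finally show ?thesis .
qed

text \<open>The tent integral under \<open>P\<close> is a weighted integral of \<open>f\<close> over
  the ball. These bounds translate between pointwise estimates of a density and quantities that
  converge weakly.\<close>

lemma integral_tent_bounds:
  assumes "prob_space P" "sets P = sets borel" "lebesgue_density P f"
  shows "(\<And>x. x \<in> ball z r \<Longrightarrow> f x \<le> c) \<Longrightarrow> (\<integral>x. tent z r x \<partial>P) \<le> c * (\<integral>x. tent z r x \<partial>lebesgue)"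
    and "(\<And>x. x \<in> ball z r \<Longrightarrow> c \<le> f x) \<Longrightarrow> c * (\<integral>x. tent z r x \<partial>lebesgue) \<le> (\<integral>x. tent z r x \<partial>P)"
proof -
  interpret prob_space P by fact
  have "integrable P (tent z r)"
    using tent_le[of z r] tent_nonneg[of z r] assms(2)
    by (intro integrable_const_bound[where B = "\<bar>r\<bar>"]) (auto simp: measurable_cong_sets[OF assms(2) refl])
  then have int: "integrable lebesgue (\<lambda>x. f x * tent z r x)"
    by (simp add: integral_lebesgue_density[OF assms(2,3)])
  have eq: "(\<integral>x. tent z r x \<partial>P) = (\<integral>x. f x * tent z r x \<partial>lebesgue)"
    by (intro integral_lebesgue_density assms measurable_tent)
  have c: "integrable lebesgue (\<lambda>x. c * tent z r x)"
    by (intro integrable_mult_right integrable_tent)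
  show "(\<integral>x. tent z r x \<partial>P) \<le> c * (\<integral>x. tent z r x \<partial>lebesgue)"
    if "\<And>x. x \<in> ball z r \<Longrightarrow> f x \<le> c"
  proof -
    have "f x * tent z r x \<le> c * tent z r x" for x
      by (cases "x \<in> ball z r") (use that in \<open>auto intro!: mult_right_mono simp: tent_nonneg tent_outside\<close>)
    then have "(\<integral>x. f x * tent z r x \<partial>lebesgue) \<le> (\<integral>x. c * tent z r x \<partial>lebesgue)"
      by (intro integral_mono int c)
    then show ?thesis
      by (simp add: eq)
  qed
  show "c * (\<integral>x. tent z r x \<partial>lebesgue) \<le> (\<integral>x. tent z r x \<partial>P)"
    if "\<And>x. x \<in> ball z r \<Longrightarrow> c \<le> f x"
  proof -
    have "c * tent z r x \<le> f x * tent z r x" for x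
      by (cases "x \<in> ball z r") (use that in \<open>auto intro!: mult_right_mono simp: tent_nonneg tent_outside\<close>)
    then have "(\<integral>x. c * tent z r x \<partial>lebesgue) \<le> (\<integral>x. f x * tent z r x \<partial>lebesgue)"
      by (intro integral_mono int c)
    then show ?thesis
      by (simp add: eq)
  qed
qed

section \<open>A single log-concave density\<close>

text \<open>On the open convex set \<open>C\<close> the function \<open>- ln f\<close> is finite and
  convex, hence continuous, and \<open>f\<close> is recovered from it by \<open>exp\<close>.\<close>

lemma isCont_interior_support:
  fixes f :: "'a::euclidean_space \<Rightarrow> real"
  assumes "log_concave_fun f" "x \<in> interior {x. 0 < f x}"
  shows "isCont f x"
proof -
  define C where "C = interior {x. 0 < f x}"
  have C: "open C" "convex C"
    unfolding C_def using convex_superlevel(2)[OF assms(1)] by (auto intro: convex_interior)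
  have pos: "0 < f y" if "y \<in> C" for y
    using that interior_subset by (auto simp: C_def)
  have "convex_on C (\<lambda>y. - ln (f y))"
  proof (rule convex_onI)
    fix t :: real and y z
    assume t: "0 < t" "t < 1" and yz: "y \<in> C" "z \<in> C"
    then have fyz: "0 < f y" "0 < f z"
      by (auto intro: pos)
    have "f y powr (1 - t) * f z powr t \<le> f ((1 - t) *\<^sub>R y + t *\<^sub>R z)"
      using t by (intro log_concave_funD assms) auto
    moreover have "0 < f y powr (1 - t) * f z powr t"
      using fyz by simp
    ultimately have "ln (f y powr (1 - t) * f z powr t) \<le> ln (f ((1 - t) *\<^sub>R y + t *\<^sub>R z))"
      by (intro ln_mono) auto
    moreover have "ln (f y powr (1 - t) * f z powr t) = (1 - t) * ln (f y) + t * ln (f z)"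
      using fyz by (simp add: ln_mult ln_powr)
    ultimately show "- ln (f ((1 - t) *\<^sub>R y + t *\<^sub>R z)) \<le> (1 - t) * - ln (f y) + t * - ln (f z)"
      by simp
  qed (rule C)
  then have "continuous_on C (\<lambda>y. - ln (f y))"
    by (intro convex_on_continuous C)
  from continuous_on_exp[OF continuous_on_minus[OF this]]
  have "continuous_on C (\<lambda>y. exp (- (- ln (f y))))" .
  also have "?this \<longleftrightarrow> continuous_on C f"
    using pos by (intro continuous_on_cong) auto
  finally show ?thesis
    using assms(2) C by (simp add: C_def continuous_on_eq_continuous_at)
qed

text \<open>Outside the closure of the support \<open>f\<close> is locally zero, so discontinuities
  can only lie on the frontier of a convex set, which is a null set.\<close>

lemma AE_isCont:
  fixes f :: "'a::euclidean_space \<Rightarrow> real"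
  assumes "log_concave_fun f"
  shows "AE x in lebesgue. isCont f x"
proof -
  have "isCont f x" if "x \<notin> frontier {x. 0 < f x}" for x
  proof (cases "x \<in> interior {x. 0 < f x}")
    case True
    then show ?thesis
      by (intro isCont_interior_support assms)
  next
    case False
    then have x: "x \<in> - closure {x. 0 < f x}"
      using that by (simp add: frontier_def)
    have "f y = 0" if "y \<in> - closure {x. 0 < f x}" for y
    proof -
      have "y \<notin> {x. 0 < f x}"
        using that subsetD[OF closure_subset, of y "{x. 0 < f x}"] by auto
      then show ?thesis
        using log_concave_fun_nonneg[OF assms, of y] by simp
    qed
    moreover have "open (- closure {x. 0 < f x})"
      by (rule open_Compl[OF closed_closure])
    ultimately have "\<forall>\<^sub>F y in nhds x. f y = 0"
      unfolding eventually_nhds using x by metis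
    then show ?thesis
      using isCont_cong[of f "\<lambda>_. 0" x] by simp
  qed
  then have "{x \<in> space lebesgue. \<not> isCont f x} \<subseteq> frontier {x. 0 < f x}"
    by (intro subsetI) (metis (mono_tags, lifting) mem_Collect_eq)
  moreover have "frontier {x. 0 < f x} \<in> null_sets lebesgue"
    using negligible_convex_frontier[OF convex_superlevel(2)[OF assms]]
    by (simp only: negligible_iff_null_sets)
  ultimately show ?thesis
    by (intro AE_I'[of "frontier {x. 0 < f x}"])
qed

text \<open>A convex support with empty interior would be a null set, leaving \<open>P\<close> with
  total mass 0. Continuity at an interior point then yields the ball.\<close>

lemma bounded_below_on_ball:
  fixes f :: "'a::euclidean_space \<Rightarrow> real"
  assumes "prob_space P" "sets P = sets borel" "lebesgue_density P f" "log_concave_fun f"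
  obtains p \<rho> b where "0 < \<rho>" "0 < b" "\<And>q. q \<in> ball p \<rho> \<Longrightarrow> b \<le> f q"
proof -
  interpret prob_space P by fact
  have "interior {x. 0 < f x} \<noteq> {}"
  proof
    assume "interior {x. 0 < f x} = {}"
    then have "{x. 0 < f x} \<in> null_sets lebesgue"
      using negligible_convex_interior[OF convex_superlevel(2)[OF assms(4)]]
      by (simp only: negligible_iff_null_sets)
    moreover have "{x \<in> space lebesgue. \<not> f x = 0} \<subseteq> {x. 0 < f x}"
      using log_concave_fun_nonneg[OF assms(4)] by (auto simp: order.strict_iff_order)
    ultimately have zero: "AE x in lebesgue. f x = 0"
      by (rule AE_I')
    have "(\<integral>\<^sup>+x. ennreal (f x) * indicator UNIV x \<partial>lebesgue) = (\<integral>\<^sup>+(x::'a). 0 \<partial>lebesgue)"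
      by (rule nn_integral_cong_AE) (use zero in \<open>eventually_elim, simp\<close>)
    moreover have "emeasure P UNIV = (\<integral>\<^sup>+x. ennreal (f x) * indicator UNIV x \<partial>lebesgue)"
      using assms(3) by (auto simp: lebesgue_density_def)
    moreover have "emeasure P UNIV = 1"
      using emeasure_space_1 sets_eq_imp_space_eq[OF assms(2)] by simp
    ultimately show False by simp
  qed
  then obtain p where p: "p \<in> interior {x. 0 < f x}" by blast
  then have "0 < f p"
    using interior_subset by blast
  have "isCont f p"
    by (intro isCont_interior_support assms p)
  then have "\<forall>\<^sub>F x in nhds p. f p / 2 < f x"
    using \<open>0 < f p\<close> by (intro order_tendstoD(1)) (auto simp: isCont_def tendsto_at_iff_tendsto_nhds)
  then obtain \<rho> where "0 < \<rho>" "\<And>q. dist q p < \<rho> \<Longrightarrow> f p / 2 < f q"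
    by (auto simp: eventually_nhds_metric)
  then show ?thesis
    using that[of \<rho> "f p / 2" p] \<open>0 < f p\<close> by (auto simp: dist_commute intro: less_imp_le)
qed

text \<open>The geometric mean of \<open>f x\<close> and \<open>b\<close> is a lower bound for \<open>f\<close> on the ball of radius \<open>\<rho> / 2\<close>
  halfway between \<open>p\<close> and \<open>x\<close>, so it is controlled by the mass of that ball.\<close>

lemma midpoint_ball_mass:
  assumes "prob_space P" "sets P = sets borel" "lebesgue_density P f" "log_concave_fun f"
    and "0 < \<rho>" "0 < b" "\<And>q. q \<in> ball p \<rho> \<Longrightarrow> b \<le> f q" and "0 \<le> a" "a \<le> f x"
  shows "sqrt (a * b) * measure lebesgue (ball (0::'a::euclidean_space) (\<rho> / 2))
    \<le> measure P (ball ((1 / 2) *\<^sub>R (p + x :: 'a)) (\<rho> / 2))"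
proof -
  interpret prob_space P by fact
  let ?B = "ball ((1 / 2) *\<^sub>R (p + x)) (\<rho> / 2)"
  have ge: "sqrt (a * b) \<le> f w" if w: "w \<in> ?B" for w
  proof -
    \<comment> \<open>The point \<open>w\<close> is the midpoint of \<open>x\<close> and its
      reflection \<open>2 *\<^sub>R w - x\<close>. The reflection doubles distances to the centre,
      so it stays within \<open>\<rho>\<close> of \<open>p\<close>.\<close>
    have "2 *\<^sub>R w - x - p = 2 *\<^sub>R (w - (1 / 2) *\<^sub>R (p + x))"
      by (simp add: algebra_simps)
    then have "norm (2 *\<^sub>R w - x - p) = 2 * norm (w - (1 / 2) *\<^sub>R (p + x))"
      by simp
    then have "b \<le> f (2 *\<^sub>R w - x)"
      using w by (intro assms(7)) (auto simp: dist_norm norm_minus_commute)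
    then have "a powr (1 / 2) * b powr (1 / 2) \<le> f ((1 / 2) *\<^sub>R x + (1 / 2) *\<^sub>R (2 *\<^sub>R w - x))"
      using assms(6,8,9) by (intro log_concave_fun_ge assms(4)) auto
    then show ?thesis
      using assms(6,8) by (simp add: powr_half_sqrt real_sqrt_mult algebra_simps)
  qed
  have "measure lebesgue ?B = measure lebesgue (ball (0::'a) (\<rho> / 2))"
    using \<open>0 < \<rho>\<close> by (simp add: content_ball)
  then have "ennreal (sqrt (a * b) * measure lebesgue (ball (0::'a) (\<rho> / 2)))
      = ennreal (sqrt (a * b)) * emeasure lebesgue ?B"
    using emeasure_lborel_ball_finite[of "(1 / 2) *\<^sub>R (p + x)" "\<rho> / 2"] assms(6,8)
    by (subst emeasure_eq_ennreal_measure) (auto simp: ennreal_mult)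
  also have "\<dots> = (\<integral>\<^sup>+w. ennreal (sqrt (a * b)) * indicator ?B w \<partial>lebesgue)"
    by (subst nn_integral_cmult_indicator) auto
  also have "\<dots> \<le> (\<integral>\<^sup>+w. ennreal (f w) * indicator ?B w \<partial>lebesgue)"
    by (intro nn_integral_mono) (auto simp: indicator_def ge intro: ennreal_leI)
  also have "\<dots> = emeasure P ?B"
    using assms(3) by (auto simp: lebesgue_density_def)
  also have "\<dots> = ennreal (measure P ?B)"
    by (rule emeasure_eq_measure)
  finally show ?thesis
    by simp
qed

text \<open>A very large value \<open>f x\<close> would give the ball halfway between
  \<open>p\<close> and \<open>x\<close> a mass above 1.\<close>

lemma log_concave_density_bounded:
  fixes f :: "'a::euclidean_space \<Rightarrow> real"
  assumes "prob_space P" "sets P = sets borel" "lebesgue_density P f" "log_concave_fun f"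
  obtains M where "0 \<le> M" "\<And>x. f x \<le> M"
proof -
  interpret prob_space P by fact
  obtain p \<rho> b where b: "0 < \<rho>" "0 < b" "\<And>q. q \<in> ball p \<rho> \<Longrightarrow> b \<le> f q"
    using bounded_below_on_ball[OF assms] by metis
  define V where "V = measure lebesgue (ball (0::'a) (\<rho> / 2))"
  have V: "0 < V"
    unfolding V_def using b by (simp add: content_ball_pos)
  have "f x \<le> (1 / V)\<^sup>2 / b" for x
  proof -
    have nn: "0 \<le> f x" by (rule log_concave_fun_nonneg[OF assms(4)])
    have "sqrt (f x * b) * V \<le> 1"
      using midpoint_ball_mass[OF assms b nn order_refl]
      by (auto simp: V_def intro: order_trans[OF _ prob_le_1])
    then have "sqrt (f x * b) \<le> 1 / V"
      using V by (simp add: field_simps)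
    then have "(sqrt (f x * b))\<^sup>2 \<le> (1 / V)\<^sup>2"
      using nn b by (intro power_mono) auto
    then have "f x * b \<le> (1 / V)\<^sup>2"
      using nn b by simp
    then show ?thesis
      using b by (simp add: pos_le_divide_eq)
  qed
  then show ?thesis
    using that[of "(1 / V)\<^sup>2 / b"] b by auto
qed

text \<open>For a distant \<open>x\<close> with \<open>f x \<ge> e\<close> the midpoint ball has
  mass at least a constant depending only on \<open>e\<close>, yet it lies outside a ball that
  carries almost all mass.\<close>

lemma log_concave_density_tendsto_0:
  fixes f :: "'a::euclidean_space \<Rightarrow> real"
  assumes "prob_space P" "sets P = sets borel" "lebesgue_density P f" "log_concave_fun f"
  shows "(f \<longlongrightarrow> 0) at_infinity"
proof (rule tendstoI)
  interpret prob_space P by fact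
  have sp: "space P = UNIV"
    using sets_eq_imp_space_eq[OF assms(2)] by simp
  obtain p \<rho> b where b: "0 < \<rho>" "0 < b" "\<And>q. q \<in> ball p \<rho> \<Longrightarrow> b \<le> f q"
    using bounded_below_on_ball[OF assms] by metis
  define V where "V = measure lebesgue (ball (0::'a) (\<rho> / 2))"
  have V: "0 < V"
    unfolding V_def using b by (simp add: content_ball_pos)
  fix e :: real assume "0 < e"
  then have m: "0 < sqrt (e * b) * V"
    using V b by simp
  have "(\<lambda>k. measure P (cball p (real k))) \<longlonglongrightarrow> measure P (\<Union>k. cball p (real k))"
    by (intro finite_Lim_measure_incseq) (auto simp: assms(2) incseq_def)
  also have "(\<Union>k. cball p (real k)) = space P"
    using sp real_arch_simple by auto
  finally have "\<forall>\<^sub>F k in sequentially. 1 - sqrt (e * b) * V < measure P (cball p (real k))"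
    using m prob_space by (intro order_tendstoD(1)) auto
  then obtain k where k: "1 - sqrt (e * b) * V < measure P (cball p (real k))"
    using eventually_happens'[OF sequentially_bot] by blast
  \<comment> \<open>The threshold puts the midpoint at distance at least
    \<open>k + \<rho> / 2 + 1 / 2\<close> from \<open>p\<close>, so its ball of radius
    \<open>\<rho> / 2\<close> misses \<open>cball p k\<close>.\<close>
  have "f x < e" if x: "2 * real k + \<rho> + norm p + 1 \<le> norm x" for x
  proof (rule ccontr)
    assume "\<not> f x < e"
    let ?z = "(1 / 2) *\<^sub>R (p + x)"
    have "sqrt (e * b) * V \<le> measure P (ball ?z (\<rho> / 2))"
      unfolding V_def using \<open>0 < e\<close> \<open>\<not> f x < e\<close> by (intro midpoint_ball_mass[OF assms b]) auto
    also have "\<dots> \<le> measure P (space P - cball p (real k))"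
    proof (intro finite_measure_mono)
      show "ball ?z (\<rho> / 2) \<subseteq> space P - cball p (real k)"
      proof
        fix w assume w: "w \<in> ball ?z (\<rho> / 2)"
        have "?z - p = (1 / 2) *\<^sub>R (x - p)"
          using scaleR_left_distrib[of "1 / 2" "1 / 2" p] by (simp add: algebra_simps)
        then have "dist ?z p = (1 / 2) * norm (x - p)"
          by (simp add: dist_norm)
        also have "\<dots> \<ge> (1 / 2) * (2 * real k + \<rho> + 1)"
          using x norm_triangle_ineq2[of x p] by (intro mult_left_mono) auto
        finally show "w \<in> space P - cball p (real k)"
          using w dist_triangle[of ?z p w] by (auto simp: sp dist_commute field_simps)
      qed
    qed (auto simp: assms(2) sp)
    also have "\<dots> = 1 - measure P (cball p (real k))"
      by (intro prob_compl) (simp add: assms(2))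
    finally show False
      using k by simp
  qed
  then show "\<forall>\<^sub>F x in at_infinity. dist (f x) 0 < e"
    using log_concave_fun_nonneg[OF assms(4)] unfolding eventually_at_infinity
    by (auto simp: dist_real_def)
qed

text \<open>Since \<open>A\<close> is linear on rays, \<open>h\<close> times \<open>exp A\<close> is log-concave along rays from \<open>p\<close>; dropping by
  the factor \<open>exp (- 1)\<close> on the way to the sphere forces geometric decay beyond it.\<close>

lemma ray_decay:
  assumes "log_concave_fun h" "sublinear A" "0 < R" "0 < b" "b \<le> h p"
    and sph: "\<And>y. norm (y - p) = R \<Longrightarrow> h y * exp (A (y - p)) \<le> b * exp (- 1)"
    and x: "R \<le> norm (x - p)"
  shows "h x * exp (A (x - p)) \<le> b * exp (- (norm (x - p) / R))"
proof -
  \<comment> \<open>This is the ratio at which the segment from \<open>p\<close> to \<open>x\<close>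
    crosses the sphere of radius \<open>R\<close>.\<close>
  define s where "s = R / norm (x - p)"
  have s: "0 < s" "s \<le> 1"
    using x \<open>0 < R\<close> less_le_trans[OF \<open>0 < R\<close> x] by (auto simp: s_def)
  define W where "W = h x * exp (A (x - p))"
  have h: "0 \<le> h x" by (rule log_concave_fun_nonneg[OF assms(1)])
  then have W: "0 \<le> W" by (simp add: W_def)
  define y where "y = s *\<^sub>R x + (1 - s) *\<^sub>R p"
  have yp: "y - p = s *\<^sub>R (x - p)"
    by (simp add: y_def algebra_simps)
  have "norm (y - p) = R"
    using s x \<open>0 < R\<close> unfolding yp by (auto simp: s_def)
  then have "h y * exp (A (y - p)) \<le> b * exp (- 1)"
    by (rule sph)
  moreover have "h x powr s * b powr (1 - s) \<le> h y"
    unfolding y_def using assms s h by (intro log_concave_fun_ge[OF assms(1)]) auto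
  ultimately have "h x powr s * b powr (1 - s) * exp (A (y - p)) \<le> b * exp (- 1)"
    by (meson exp_ge_zero mult_right_mono order_trans)
  moreover have "A (y - p) = s * A (x - p)"
    using assms(2) s by (simp add: yp sublinear_def)
  ultimately have "W powr s * b powr (1 - s) \<le> b * exp (- 1)"
    using h by (simp add: W_def powr_mult powr_def[of "exp _"] mult_ac)
  moreover have "b powr s * b powr (1 - s) = b"
    using \<open>0 < b\<close> by (simp flip: powr_add)
  ultimately have "W powr s * b powr (1 - s) \<le> (b powr s * b powr (1 - s)) * exp (- 1)"
    by (simp only:)
  also have "\<dots> = (b powr s * exp (- 1)) * b powr (1 - s)"
    by (simp only: mult_ac)
  finally have "W powr s \<le> b powr s * exp (- 1)"
    using \<open>0 < b\<close> by simp
  \<comment> \<open>Since \<open>1 / s = norm (x - p) / R\<close>, taking this power turns the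
    single factor \<open>exp (- 1)\<close> into the claimed exponential decay.\<close>
  then have "(W powr s) powr (1 / s) \<le> (b powr s * exp (- 1)) powr (1 / s)"
    using s by (intro powr_mono2) auto
  also have "(W powr s) powr (1 / s) = W"
    using s W by (simp add: powr_powr)
  also have "(b powr s * exp (- 1)) powr (1 / s) = b * exp (- (1 / s))"
    using s \<open>0 < b\<close> by (simp add: powr_mult powr_powr powr_def[of "exp _"])
  finally show ?thesis
    by (simp add: W_def s_def)
qed

text \<open>A finite subcover reduces the claim to finitely many eventual statements, which hold
  simultaneously.\<close>

lemma eventually_all_compact:
  fixes K :: "'a::metric_space set"
  assumes "compact K" "\<And>x0. x0 \<in> K \<Longrightarrow> \<exists>r>0. \<forall>\<^sub>F n in F. \<forall>x\<in>ball x0 r \<inter> K. Q n x"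
  shows "\<forall>\<^sub>F n in F. \<forall>x\<in>K. Q n x"
proof -
  obtain r where r: "\<And>x0. x0 \<in> K \<Longrightarrow> 0 < r x0"
    "\<And>x0. x0 \<in> K \<Longrightarrow> \<forall>\<^sub>F n in F. \<forall>x\<in>ball x0 (r x0) \<inter> K. Q n x"
    using assms(2) by metis
  obtain C where C: "C \<subseteq> K" "finite C" "K \<subseteq> (\<Union>x\<in>C. ball x (r x))"
    by (rule compactE_image[OF assms(1), of K "\<lambda>x. ball x (r x)"]) (use r(1) in force)+
  have "\<forall>\<^sub>F n in F. \<forall>x0\<in>C. \<forall>x\<in>ball x0 (r x0) \<inter> K. Q n x"
    using C r(2) by (intro eventually_ball_finite) auto
  then show ?thesis
    by eventually_elim (use C in blast)
qed

section \<open>Integrability of exponential tails\<close>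

lemma power_le_fact_mult_exp:
  fixes x :: real
  assumes "0 \<le> x"
  shows "x ^ n \<le> fact n * exp x"
proof -
  have "sum (\<lambda>k. x ^ k /\<^sub>R fact k) {n} \<le> (\<Sum>k. x ^ k /\<^sub>R fact k)"
    using assms by (intro sum_le_suminf summable_exp_generic) auto
  then show ?thesis
    by (simp add: exp_def field_simps)
qed

text \<open>Half of the exponential rate is spent on absorbing the power, and the other half is kept
  for summability.\<close>

lemma power_mult_exp_le:
  fixes s x :: real
  assumes "0 < s" "0 \<le> x"
  shows "x ^ d * exp (- s * x) \<le> (2 / s) ^ d * fact d * exp (- (s / 2) * x)"
proof -
  have "x ^ d = (2 / s * (s / 2 * x)) ^ d"
    using assms(1) by (intro arg_cong[of _ _ "\<lambda>y. y ^ d"]) (simp add: field_simps)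
  also have "\<dots> = (2 / s) ^ d * (s / 2 * x) ^ d"
    by (rule power_mult_distrib)
  also have "\<dots> \<le> (2 / s) ^ d * (fact d * exp (s / 2 * x))"
    using assms by (intro mult_left_mono power_le_fact_mult_exp) auto
  finally have "x ^ d * exp (- s * x) \<le> (2 / s) ^ d * (fact d * exp (s / 2 * x)) * exp (- s * x)"
    by (rule mult_right_mono) simp
  also have "\<dots> = (2 / s) ^ d * fact d * (exp (s / 2 * x) * exp (- s * x))"
    by (simp only: mult_ac)
  also have "exp (s / 2 * x) * exp (- s * x) = exp (- (s / 2) * x)"
    unfolding exp_add[symmetric] by (rule arg_cong[of _ _ exp]) (simp add: field_simps)
  finally show ?thesis .
qed

text \<open>The integrand is dominated by a sum of multiples of ball indicators with integer radii.
  Ball volumes grow polynomially, so the resulting series is bounded by a geometric one.\<close>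

lemma nn_integral_exp_norm_finite:
  assumes "0 < s"
  shows "(\<integral>\<^sup>+x. ennreal (exp (- s * norm (x::'a::euclidean_space))) \<partial>lebesgue) < \<infinity>"
proof -
  define d where "d = DIM('a)"
  define V where "V = unit_ball_vol (real d)"
  have V: "0 \<le> V" by (simp add: V_def)
  let ?c = "\<lambda>k. exp (- s * real k) * (V * (real k + 1) ^ d)"
  have "(\<integral>\<^sup>+x. ennreal (exp (- s * norm (x::'a))) \<partial>lebesgue)
      \<le> (\<integral>\<^sup>+x. (\<Sum>k. ennreal (exp (- s * real k)) * indicator (ball (0::'a) (real k + 1)) x) \<partial>lebesgue)"
  proof (rule nn_integral_mono)
    fix x :: 'a
    \<comment> \<open>This single term of the series already dominates the integrand at
      \<open>x\<close>.\<close>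
    define k where "k = nat \<lfloor>norm x\<rfloor>"
    have k: "real k \<le> norm x" "norm x < real k + 1"
      by (auto simp: k_def)
    define F where "F = (\<lambda>k. ennreal (exp (- s * real k)) * indicator (ball 0 (real k + 1)) x)"
    have "ennreal (exp (- s * norm x)) \<le> F k"
      using k assms by (auto simp: F_def intro!: ennreal_leI)
    also have "\<dots> = sum F {k}"
      by simp
    also have "\<dots> \<le> (\<Sum>k. F k)"
      by (intro sum_le_suminf summableI) auto
    finally show "ennreal (exp (- s * norm x))
      \<le> (\<Sum>k. ennreal (exp (- s * real k)) * indicator (ball 0 (real k + 1)) x)"
      by (simp only: F_def)
  qed
  also have "\<dots> = (\<Sum>k. \<integral>\<^sup>+x. ennreal (exp (- s * real k)) * indicator (ball (0::'a) (real k + 1)) x \<partial>lebesgue)"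
    by (intro nn_integral_suminf borel_measurable_times_ennreal borel_measurable_const
        borel_measurable_indicator) auto
  also have "\<dots> = (\<Sum>k. ennreal (?c k))"
  proof (rule suminf_cong)
    fix k
    have "emeasure lebesgue (ball (0::'a) (real k + 1)) = ennreal (V * (real k + 1) ^ d)"
      by (simp add: emeasure_ball d_def V_def)
    then have "(\<integral>\<^sup>+x. ennreal (exp (- s * real k)) * indicator (ball (0::'a) (real k + 1)) x \<partial>lebesgue)
        = ennreal (exp (- s * real k)) * ennreal (V * (real k + 1) ^ d)"
      by (subst nn_integral_cmult_indicator) auto
    also have "\<dots> = ennreal (?c k)"
      by (rule ennreal_mult'[symmetric]) simp
    finally show "(\<integral>\<^sup>+x. ennreal (exp (- s * real k)) * indicator (ball (0::'a) (real k + 1)) x \<partial>lebesgue)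
        = ennreal (?c k)" .
  qed
  also have "\<dots> < \<infinity>"
  proof -
    define C where "C = V * exp s * ((2 / s) ^ d * fact d) * exp (- (s / 2))"
    have cnn: "0 \<le> ?c k" for k
      using V by (intro mult_nonneg_nonneg) auto
    have le: "?c k \<le> C * exp (- (s / 2)) ^ k" for k
    proof -
      \<comment> \<open>The exponent is shifted to match the volume factor
        \<open>(real k + 1) ^ d\<close>, at the cost of the constant \<open>exp s\<close>.\<close>
      have "exp (- s * real k) = exp s * exp (- s * (real k + 1))"
        unfolding exp_add[symmetric] by (rule arg_cong[of _ _ exp]) (simp add: distrib_left)
      then have "?c k = (exp s * exp (- s * (real k + 1))) * (V * (real k + 1) ^ d)"
        by (rule arg_cong)
      also have "\<dots> = V * exp s * ((real k + 1) ^ d * exp (- s * (real k + 1)))"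
        by (simp only: mult_ac)
      also have "\<dots> \<le> V * exp s * ((2 / s) ^ d * fact d * exp (- (s / 2) * (real k + 1)))"
        using assms V by (intro mult_left_mono power_mult_exp_le mult_nonneg_nonneg) auto
      also have "exp (- (s / 2) * (real k + 1)) = exp (- (s / 2)) * exp (- (s / 2)) ^ k"
        unfolding exp_of_nat_mult[symmetric] exp_add[symmetric]
        by (rule arg_cong[of _ _ exp]) (simp add: distrib_left)
      finally show ?thesis
        by (simp only: C_def mult_ac)
    qed
    have "summable (\<lambda>k. C * exp (- (s / 2)) ^ k)"
      using assms by (intro summable_mult summable_geometric) auto
    then have "summable ?c"
      by (rule summable_comparison_test'[where N = 0])
         (unfold real_norm_def abs_of_nonneg[OF cnn], rule le)
    then have "(\<Sum>k. ennreal (?c k)) = ennreal (suminf ?c)"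
      by (rule suminf_ennreal2[OF cnn])
    then show ?thesis
      by (simp only: ennreal_less_top infinity_ennreal_def)
  qed
  finally show ?thesis .
qed

section \<open>Weakly convergent sequences of log-concave densities\<close>

locale lc_limit =
  fixes P :: "'a::euclidean_space measure" and Pn :: "nat \<Rightarrow> 'a measure"
    and f :: "'a \<Rightarrow> real" and fn :: "nat \<Rightarrow> 'a \<Rightarrow> real"
  assumes lc_P: "P \<in> lc_distributions" and lc_Pn: "\<And>n. Pn n \<in> lc_distributions"
    and density_f: "lc_density P f" and density_fn: "\<And>n. lc_density (Pn n) (fn n)"
    and conv: "weakly_converges Pn P"
begin

lemma prob_P: "prob_space P" and sets_P: "sets P = sets borel"
  and prob_Pn: "prob_space (Pn n)" and sets_Pn: "sets (Pn n) = sets borel"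
  using lc_P lc_Pn by (auto simp: lc_distributions_def)

lemma dens_f: "lebesgue_density P f" and lc_f: "log_concave_fun f"
  and dens_fn: "lebesgue_density (Pn n) (fn n)" and lc_fn: "log_concave_fun (fn n)"
  using density_f density_fn by (auto simp: lc_density_def)

lemma tent_tendsto: "(\<lambda>n. \<integral>x. tent z r x \<partial>Pn n) \<longlonglongrightarrow> (\<integral>x. tent z r x \<partial>P)"
  using conv continuous_on_tent[of z r] bounded_tent[of z r]
  unfolding weakly_converges_def by blast

text \<open>Where \<open>fn n < c'\<close> at a point close to \<open>x0\<close>, a separating hyperplane makes \<open>fn n < c'\<close> on a
  half-space that almost touches \<open>x0\<close>. By compactness of the sphere of normal directions, a fixed
  small ball lies in infinitely many of these half-spaces, and there the limit density is at
  least \<open>c\<close>.\<close>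

lemma eventually_ge_near:
  assumes \<delta>: "0 < \<delta>" and ge: "\<And>x. x \<in> ball x0 \<delta> \<Longrightarrow> c \<le> f x" and "c' < c"
  shows "\<exists>r>0. \<forall>\<^sub>F n in sequentially. \<forall>x\<in>ball x0 r. c' \<le> fn n x"
proof (rule ccontr)
  assume no: "\<not> ?thesis"
  \<comment> \<open>Failure is used at radius \<open>1 / Suc k\<close> and beyond index
    \<open>k\<close>. The indices \<open>\<sigma> k\<close> need not increase;
    \<open>k \<le> \<sigma> k\<close> suffices for them to tend to infinity.\<close>
  have "\<exists>n x. k \<le> n \<and> x \<in> ball x0 (1 / Suc k) \<and> fn n x < c'" for k
  proof -
    have "0 < 1 / real (Suc k)" by simp
    then show ?thesis
      using no unfolding eventually_sequentially by (metis not_le)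
  qed
  then obtain \<sigma> X where \<sigma>: "\<And>k. k \<le> \<sigma> k" and X: "\<And>k. X k \<in> ball x0 (1 / Suc k)"
    and lt: "\<And>k. fn (\<sigma> k) (X k) < c'"
    by metis
  have "\<exists>u. norm u = 1 \<and> (\<forall>z. 0 < u \<bullet> (z - X k) \<longrightarrow> fn (\<sigma> k) z < c')" for k
  proof (cases "{z. c' \<le> fn (\<sigma> k) z} = {}")
    case True
    obtain u :: 'a where "norm u = 1"
      using vector_choose_size[of 1] by auto
    then show ?thesis
      using True by (auto simp: not_le)
  next
    case False
    have "{z. c' \<le> fn (\<sigma> k) z} \<inter> {X k} = {}"
      using lt[of k] by auto
    then obtain a b where a: "a \<noteq> 0" "\<And>z. c' \<le> fn (\<sigma> k) z \<Longrightarrow> a \<bullet> z \<le> b" "b \<le> a \<bullet> X k"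
      using separating_hyperplane_sets[OF convex_superlevel(1)[OF lc_fn] convex_singleton False]
      by fastforce
    have "fn (\<sigma> k) z < c'" if "0 < (a /\<^sub>R norm a) \<bullet> (z - X k)" for z
    proof -
      have "0 < a \<bullet> (z - X k)"
        using that a(1) by (simp add: zero_less_mult_iff)
      then show ?thesis
        using a(2)[of z] a(3) by (force simp: inner_diff_right)
    qed
    then show ?thesis
      using a(1) by (intro exI[of _ "a /\<^sub>R norm a"]) auto
  qed
  then obtain u where u: "\<And>k. norm (u k) = 1"
    and half: "\<And>k z. 0 < u k \<bullet> (z - X k) \<Longrightarrow> fn (\<sigma> k) z < c'"
    by metis
  have "seq_compact (sphere (0::'a) 1)"
    by (simp add: compact_imp_seq_compact)
  moreover have "\<forall>k. u k \<in> sphere 0 1"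
    using u by simp
  ultimately obtain l r where l: "l \<in> sphere 0 1" and r: "strict_mono r" and "(u \<circ> r) \<longlonglongrightarrow> l"
    by (meson seq_compactE)
  then have ul: "(\<lambda>k. u (r k)) \<longlonglongrightarrow> l"
    by (simp add: comp_def)
  have Xlim: "X \<longlonglongrightarrow> x0"
    unfolding tendsto_iff
  proof (intro allI impI)
    fix e :: real assume "0 < e"
    then have "\<forall>\<^sub>F k in sequentially. 1 / real (Suc k) < e"
      using LIMSEQ_inverse_real_of_nat by (simp add: tendsto_iff inverse_eq_divide)
    then show "\<forall>\<^sub>F k in sequentially. dist (X k) x0 < e"
      by eventually_elim (use X in \<open>force simp: dist_commute intro: less_trans\<close>)
  qed
  have Xr: "(\<lambda>k. X (r k)) \<longlonglongrightarrow> x0"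
    using LIMSEQ_subseq_LIMSEQ[OF Xlim r] by (simp add: comp_def)
  have \<sigma>r: "filterlim (\<lambda>k. \<sigma> (r k)) at_top sequentially"
    by (rule filterlim_at_top_mono[OF filterlim_subseq[OF r]]) (simp add: \<sigma>)
  \<comment> \<open>A shift by \<open>\<delta> / 2\<close> along the limit direction places
    \<open>ball z (\<delta> / 4)\<close> inside \<open>ball x0 \<delta>\<close> and well inside the
    half-spaces with normals close to \<open>l\<close>.\<close>
  define z where "z = x0 + (\<delta> / 2) *\<^sub>R l"
  define G where "G = (\<integral>x. tent z (\<delta> / 4) x \<partial>lebesgue)"
  have G: "0 < G"
    unfolding G_def using \<delta> by (intro integral_tent_pos) simp
  \<comment> \<open>With these tolerances the errors sum to at most
    \<open>\<delta> / 32 + \<delta> / 16 + \<delta> / 4\<close>, below the main term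
    \<open>\<delta> / 2\<close> of the inner product.\<close>
  have near: "\<forall>\<^sub>F k in sequentially. norm (X (r k) - x0) < \<delta> / 16 \<and> norm (u (r k) - l) < 1 / 16"
    using tendstoD[OF Xr, of "\<delta> / 16"] tendstoD[OF ul, of "1 / 16"] \<delta>
    by (simp add: dist_norm eventually_conj_iff)
  have "\<forall>\<^sub>F k in sequentially. (\<integral>x. tent z (\<delta> / 4) x \<partial>Pn (\<sigma> (r k))) \<le> c' * G"
    using near
  proof eventually_elim
    case (elim k)
    have "fn (\<sigma> (r k)) y \<le> c'" if y: "y \<in> ball z (\<delta> / 4)" for y
    proof (intro less_imp_le half)
      have eq: "y - X (r k) = (\<delta> / 2) *\<^sub>R u (r k) + ((\<delta> / 2) *\<^sub>R (l - u (r k)) + (x0 - X (r k)) + (y - z))"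
        by (simp add: z_def algebra_simps)
      define e where "e = (\<delta> / 2) *\<^sub>R (l - u (r k)) + (x0 - X (r k)) + (y - z)"
      have "norm e \<le> norm ((\<delta> / 2) *\<^sub>R (l - u (r k))) + norm (x0 - X (r k)) + norm (y - z)"
        unfolding e_def by (intro norm_triangle_le add_mono order_refl norm_triangle_ineq)
      also have "\<dots> \<le> (\<delta> / 2) * (1 / 16) + \<delta> / 16 + \<delta> / 4"
        using elim y \<delta> by (intro add_mono) (auto simp: norm_minus_commute dist_norm)
      finally have "norm e < \<delta> / 2"
        using \<delta> by simp
      moreover have "\<bar>u (r k) \<bullet> e\<bar> \<le> norm e"
        using Cauchy_Schwarz_ineq2[of "u (r k)" e] u by simp
      moreover have "u (r k) \<bullet> (y - X (r k)) = \<delta> / 2 + u (r k) \<bullet> e"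
        unfolding eq e_def[symmetric] using u[of "r k"]
        by (simp add: inner_add_right flip: power2_norm_eq_inner)
      ultimately show "0 < u (r k) \<bullet> (y - X (r k))"
        by linarith
    qed
    then show ?case
      unfolding G_def by (rule integral_tent_bounds(1)[OF prob_Pn sets_Pn dens_fn])
  qed
  moreover have "(\<lambda>k. \<integral>x. tent z (\<delta> / 4) x \<partial>Pn (\<sigma> (r k))) \<longlonglongrightarrow> (\<integral>x. tent z (\<delta> / 4) x \<partial>P)"
    by (rule filterlim_compose[OF tent_tendsto \<sigma>r])
  ultimately have "(\<integral>x. tent z (\<delta> / 4) x \<partial>P) \<le> c' * G"
    by (intro tendsto_upperbound) auto
  moreover have "c * G \<le> (\<integral>x. tent z (\<delta> / 4) x \<partial>P)"
    unfolding G_def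
  proof (rule integral_tent_bounds(2)[OF prob_P sets_P dens_f], rule ge)
    fix y assume "y \<in> ball z (\<delta> / 4)"
    moreover have "dist x0 z = \<delta> / 2"
      using l \<delta> by (simp add: z_def dist_norm)
    ultimately show "y \<in> ball x0 \<delta>"
      using dist_triangle[of x0 y z] \<delta> by simp
  qed
  moreover have "c' * G < c * G"
    using G \<open>c' < c\<close> by simp
  ultimately show False by linarith
qed

text \<open>If \<open>fn n x > c'\<close> for some \<open>x\<close> near \<open>x0\<close>, then \<open>fn n \<ge> c' powr (1 - t) * b powr t\<close> at the points
  dividing the segments from \<open>x\<close> to \<open>ball p \<rho>\<close> in the ratio \<open>t : 1 - t\<close>. For small \<open>t\<close> this bound
  exceeds \<open>c\<close>, and these points cover a fixed ball near \<open>x0\<close>.\<close>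

lemma eventually_le_near:
  assumes base: "0 < \<rho>" "0 < b" "\<forall>\<^sub>F n in sequentially. \<forall>q\<in>ball p \<rho>. b \<le> fn n q"
    and \<delta>: "0 < \<delta>" and le: "\<And>x. x \<in> ball x0 \<delta> \<Longrightarrow> f x \<le> c" and "c < c'"
  shows "\<exists>r>0. \<forall>\<^sub>F n in sequentially. \<forall>x\<in>ball x0 r. fn n x \<le> c'"
proof -
  have "0 \<le> c"
    using le[of x0] log_concave_fun_nonneg[OF lc_f, of x0] \<delta> by simp
  then have c': "0 < c'"
    using \<open>c < c'\<close> by simp
  \<comment> \<open>As \<open>t\<close> tends to 0 the lower bound tends to \<open>c'\<close>, which
    exceeds \<open>c\<close>, while the dividing points approach \<open>x0\<close>. A small
    \<open>t\<close> therefore meets both requirements.\<close>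
  have lim: "((\<lambda>t. c' powr (1 - t) * b powr t) \<longlongrightarrow> c' powr (1 - 0) * b powr 0) (at_right 0)"
    using c' base(2) by (intro tendsto_intros) auto
  then have ev1: "\<forall>\<^sub>F t in at_right 0. c < c' powr (1 - t) * b powr t"
    using \<open>c < c'\<close> c' base(2) by (intro order_tendstoD(1)[OF lim]) auto
  have "((\<lambda>t. t * (dist x0 p + \<rho>)) \<longlongrightarrow> 0 * (dist x0 p + \<rho>)) (at_right 0)"
    by (intro tendsto_intros)
  then have ev2: "\<forall>\<^sub>F t in at_right 0. t * (dist x0 p + \<rho>) < \<delta>"
    using \<delta> by (intro order_tendstoD(2)) auto
  have ev3: "\<forall>\<^sub>F t in at_right 0. t \<in> {0<..<1::real}"
    by (rule eventually_at_right_real) simp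
  obtain t :: real where t: "0 < t" "t < 1" "t * (dist x0 p + \<rho>) < \<delta>"
    and m: "c < c' powr (1 - t) * b powr t"
    using eventually_happens'[OF trivial_limit_at_right_real eventually_conj[OF ev1 eventually_conj[OF ev2 ev3]]]
    by auto
  define m where "m = c' powr (1 - t) * b powr t"
  define z where "z = (1 - t) *\<^sub>R x0 + t *\<^sub>R p"
  \<comment> \<open>The displacements of \<open>w\<close> from \<open>z\<close> and of
    \<open>x\<close> from \<open>x0\<close> are each below \<open>\<eta>\<close>. Together they stay
    below \<open>t * \<rho>\<close>, and division by \<open>t\<close> in \<open>q\<close> gives
    exactly the radius \<open>\<rho>\<close>.\<close>
  define \<eta> where "\<eta> = t * \<rho> / 2"
  have \<eta>: "0 < \<eta>"
    using t base by (simp add: \<eta>_def)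
  define G where "G = (\<integral>x. tent z \<eta> x \<partial>lebesgue)"
  have G: "0 < G"
    unfolding G_def by (intro integral_tent_pos \<eta>)
  have "(\<integral>x. tent z \<eta> x \<partial>P) \<le> c * G"
    unfolding G_def
  proof (rule integral_tent_bounds(1)[OF prob_P sets_P dens_f], rule le)
    fix y assume y: "y \<in> ball z \<eta>"
    have "x0 - z = t *\<^sub>R (x0 - p)"
      by (simp add: z_def algebra_simps)
    then have "dist x0 z = t * dist x0 p"
      using t by (simp add: dist_norm)
    then have "dist x0 y < t * dist x0 p + \<eta>"
      using y dist_triangle[of x0 y z] by simp
    also have "\<dots> \<le> t * (dist x0 p + \<rho>)"
      using t base by (simp add: \<eta>_def algebra_simps)
    finally show "y \<in> ball x0 \<delta>"
      using t by simp
  qed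
  also have "\<dots> < m * G"
    using m G by (simp add: m_def)
  finally have "\<forall>\<^sub>F n in sequentially. (\<integral>x. tent z \<eta> x \<partial>Pn n) < m * G"
    using order_tendstoD(2)[OF tent_tendsto] by blast
  then have "\<forall>\<^sub>F n in sequentially. \<forall>x\<in>ball x0 \<eta>. fn n x \<le> c'"
    using base(3)
  proof eventually_elim
    case (elim n)
    show ?case
    proof (rule ccontr)
      assume "\<not> ?thesis"
      then obtain x where x: "x \<in> ball x0 \<eta>" "c' < fn n x"
        by (auto simp: not_le)
      have "m \<le> fn n w" if w: "w \<in> ball z \<eta>" for w
      proof -
        \<comment> \<open>This is the solution of
          \<open>w = (1 - t) *\<^sub>R x + t *\<^sub>R q\<close>, written as a perturbation of
          \<open>p\<close>.\<close>
        define q where "q = p + (1 / t) *\<^sub>R (w - z - (1 - t) *\<^sub>R (x - x0))"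
        have weq: "w = (1 - t) *\<^sub>R x + t *\<^sub>R q"
          using t by (simp add: q_def z_def algebra_simps)
        have "norm (w - z - (1 - t) *\<^sub>R (x - x0)) \<le> norm (w - z) + norm ((1 - t) *\<^sub>R (x - x0))"
          by (rule norm_triangle_ineq4)
        also have "\<dots> \<le> norm (w - z) + norm (x - x0)"
          using t by (simp add: mult_left_le_one_le)
        also have "\<dots> < \<eta> + \<eta>"
          using w x by (intro add_strict_mono) (auto simp: dist_norm norm_minus_commute)
        also have "\<eta> + \<eta> = t * \<rho>"
          by (simp add: \<eta>_def)
        finally have "(1 / t) * norm (w - z - (1 - t) *\<^sub>R (x - x0)) < (1 / t) * (t * \<rho>)"
          by (rule mult_strict_left_mono) (use t in simp)
        moreover have "norm (q - p) = (1 / t) * norm (w - z - (1 - t) *\<^sub>R (x - x0))"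
          using t by (simp add: q_def)
        moreover have "(1 / t) * (t * \<rho>) = \<rho>"
          using t by simp
        ultimately have "norm (q - p) < \<rho>"
          by (simp only:)
        then have "q \<in> ball p \<rho>"
          by (simp add: dist_norm norm_minus_commute)
        then have "b \<le> fn n q"
          using elim by simp
        then show ?thesis
          unfolding weq m_def using t x c' base(2)
          by (intro log_concave_fun_ge[OF lc_fn]) auto
      qed
      then have "m * G \<le> (\<integral>x. tent z \<eta> x \<partial>Pn n)"
        unfolding G_def by (rule integral_tent_bounds(2)[OF prob_Pn sets_Pn dens_fn])
      then show False
        using elim by simp
    qed
  qed
  then show ?thesis
    using \<eta> by blast
qed

lemma eventually_near_continuity_point:
  assumes base: "0 < \<rho>" "0 < b" "\<forall>\<^sub>F n in sequentially. \<forall>q\<in>ball p \<rho>. b \<le> fn n q"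
    and "isCont f x0" "0 < e"
  shows "\<exists>r>0. \<forall>\<^sub>F n in sequentially. \<forall>x\<in>ball x0 r. \<bar>fn n x - f x\<bar> < e"
proof -
  \<comment> \<open>Both one-sided lemmas need a strict gap between levels: \<open>f\<close> is kept
    within \<open>e / 8\<close> of \<open>f x0\<close>, and \<open>fn n\<close> will be kept within
    \<open>e / 4\<close>.\<close>
  obtain \<delta> where \<delta>: "0 < \<delta>" "\<And>x. dist x x0 < \<delta> \<Longrightarrow> dist (f x) (f x0) < e / 8"
    using assms(4)[unfolded continuous_at_eps_delta, rule_format, of "e / 8"] \<open>0 < e\<close> by auto
  have near: "\<bar>f x - f x0\<bar> < e / 8" if "x \<in> ball x0 \<delta>" for x
    using \<delta>(2)[of x] that by (simp add: dist_commute[of x0 x] dist_real_def)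
  have lower: "f x0 - e / 8 \<le> f x" and upper: "f x \<le> f x0 + e / 8" if "x \<in> ball x0 \<delta>" for x
    using near[OF that] by linarith+
  have "\<exists>r>0. \<forall>\<^sub>F n in sequentially. \<forall>x\<in>ball x0 r. f x0 - e / 4 \<le> fn n x"
    by (rule eventually_ge_near[OF \<delta>(1) lower]) (use \<open>0 < e\<close> in auto)
  then obtain r1 where r1: "0 < r1" "\<forall>\<^sub>F n in sequentially. \<forall>x\<in>ball x0 r1. f x0 - e / 4 \<le> fn n x"
    by blast
  have "\<exists>r>0. \<forall>\<^sub>F n in sequentially. \<forall>x\<in>ball x0 r. fn n x \<le> f x0 + e / 4"
    by (rule eventually_le_near[OF base \<delta>(1) upper]) (use \<open>0 < e\<close> in auto)
  then obtain r2 where r2: "0 < r2" "\<forall>\<^sub>F n in sequentially. \<forall>x\<in>ball x0 r2. fn n x \<le> f x0 + e / 4"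
    by blast
  have "\<forall>\<^sub>F n in sequentially. \<forall>x\<in>ball x0 (min \<delta> (min r1 r2)). \<bar>fn n x - f x\<bar> < e"
    using r1(2) r2(2)
  proof eventually_elim
    case (elim n)
    show ?case
    proof
      fix x assume x: "x \<in> ball x0 (min \<delta> (min r1 r2))"
      then have "f x0 - e / 4 \<le> fn n x" "fn n x \<le> f x0 + e / 4" "\<bar>f x - f x0\<bar> < e / 8"
        using elim near[of x] by auto
      then show "\<bar>fn n x - f x\<bar> < e"
        using \<open>0 < e\<close> by linarith
    qed
  qed
  then show ?thesis
    using \<delta>(1) r1(1) r2(1) by (intro exI[of _ "min \<delta> (min r1 r2)"]) auto
qed

text \<open>This supplies the common lower bound required by the cone argument and by
  \<open>ray_decay\<close>. Halving the bound for \<open>f\<close> creates the strict gap needed to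
  transfer it to \<open>fn n\<close>.\<close>

lemma base_ball:
  obtains p \<rho> b where "0 < \<rho>" "0 < b" "b \<le> f p"
    "\<forall>\<^sub>F n in sequentially. \<forall>q\<in>ball p \<rho>. b \<le> fn n q"
proof -
  obtain p \<rho> b where b: "0 < \<rho>" "0 < b" "\<And>q. q \<in> ball p \<rho> \<Longrightarrow> b \<le> f q"
    using bounded_below_on_ball[OF prob_P sets_P dens_f lc_f] by metis
  have "\<exists>r>0. \<forall>\<^sub>F n in sequentially. \<forall>q\<in>ball p r. b / 2 \<le> fn n q"
    by (rule eventually_ge_near[OF b(1,3)]) (use b(2) in linarith)+
  then obtain r where r: "0 < r" "\<forall>\<^sub>F n in sequentially. \<forall>q\<in>ball p r. b / 2 \<le> fn n q"
    by blast
  show ?thesis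
  proof (rule that[OF r(1) _ _ r(2)])
    show "0 < b / 2" "b / 2 \<le> f p"
      using b(3)[of p] b(1,2) by auto
  qed
qed

lemma eventually_near_isCont:
  assumes "isCont f x0" "0 < e"
  shows "\<exists>r>0. \<forall>\<^sub>F n in sequentially. \<forall>x\<in>ball x0 r. \<bar>fn n x - f x\<bar> < e"
proof -
  obtain p \<rho> b where base: "0 < \<rho>" "0 < b" "b \<le> f p"
    "\<forall>\<^sub>F n in sequentially. \<forall>q\<in>ball p \<rho>. b \<le> fn n q"
    by (rule base_ball)
  show ?thesis
    by (rule eventually_near_continuity_point[OF base(1,2,4) assms])
qed

lemma tendsto_at_isCont:
  assumes "isCont f x"
  shows "(\<lambda>n. fn n x) \<longlonglongrightarrow> f x"
proof (rule tendstoI)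
  fix e :: real assume "0 < e"
  then obtain r where r: "0 < r" "\<forall>\<^sub>F n in sequentially. \<forall>y\<in>ball x r. \<bar>fn n y - f y\<bar> < e"
    using eventually_near_isCont[OF assms] by blast
  show "\<forall>\<^sub>F n in sequentially. dist (fn n x) (f x) < e"
    using r(2) by eventually_elim (use r(1) in \<open>simp add: dist_real_def\<close>)
qed

section \<open>Uniform exponential decay of the weighted densities\<close>

lemma exponential_decay_outside_ball:
  assumes A: "sublinear A" and lim: "((\<lambda>x. f x * exp (A x)) \<longlongrightarrow> 0) at_infinity"
  obtains b R p where "0 < b" "0 < R"
    "\<forall>x. R \<le> norm (x - p) \<longrightarrow> f x * exp (A (x - p)) \<le> b * exp (- (norm (x - p) / R))"
    "\<forall>\<^sub>F n in sequentially. \<forall>x. R \<le> norm (x - p) \<longrightarrow>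
       fn n x * exp (A (x - p)) \<le> b * exp (- (norm (x - p) / R))"
proof -
  obtain p \<rho> b where base: "0 < \<rho>" "0 < b" "b \<le> f p"
    "\<forall>\<^sub>F n in sequentially. \<forall>q\<in>ball p \<rho>. b \<le> fn n q"
    by (rule base_ball)
  have contA: "continuous_on UNIV A"
    by (rule sublinear_continuous[OF A])
  \<comment> \<open>The factor \<open>exp (- A (- p))\<close> pays for moving the origin of the
    weight to \<open>p\<close>, and \<open>exp (- 3)\<close> leaves room for the losses down to
    \<open>exp (- 1)\<close>.\<close>
  have "\<forall>\<^sub>F x in at_infinity. f x * exp (A x) < b * exp (- 3) * exp (- A (- p))"
    using base by (intro order_tendstoD(2)[OF lim]) simp
  then obtain R0 where R0: "\<And>x. R0 \<le> norm x \<Longrightarrow> f x * exp (A x) < b * exp (- 3) * exp (- A (- p))"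
    unfolding eventually_at_infinity by blast
  have far: "f x * exp (A (x - p)) \<le> b * exp (- 3)" if "R0 \<le> norm x" for x
  proof -
    have "A (x + - p) \<le> A x + A (- p)"
      using A unfolding sublinear_def by blast
    then have "A (x - p) \<le> A x + A (- p)"
      by simp
    then have "f x * exp (A (x - p)) \<le> f x * exp (A x + A (- p))"
      using log_concave_fun_nonneg[OF lc_f] by (intro mult_left_mono) auto
    also have "\<dots> = (f x * exp (A x)) * exp (A (- p))"
      by (simp add: exp_add)
    also have "\<dots> \<le> (b * exp (- 3) * exp (- A (- p))) * exp (A (- p))"
      using R0[OF that] by (intro mult_right_mono) auto
    also have "\<dots> = b * exp (- 3)"
      by (simp add: exp_minus)
    finally show ?thesis .
  qed
  \<comment> \<open>Every point within distance 1 of \<open>sphere p R\<close> then has norm at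
    least \<open>R0\<close>.\<close>
  define R where "R = \<bar>R0\<bar> + norm p + 1"
  have R: "0 < R"
    by (simp add: R_def add_nonneg_pos)
  \<comment> \<open>The exponent goes from \<open>- 3\<close> to \<open>- 5 / 2\<close> by the
    oscillation of \<open>A\<close>, to \<open>- 3 / 2\<close> for the strict gap between
    \<open>f\<close> and \<open>fn n\<close>, and to \<open>- 1\<close> by the oscillation
    again.\<close>
  have near: "\<exists>r>0. \<forall>\<^sub>F n in sequentially. \<forall>x\<in>ball x0 r \<inter> sphere p R.
      fn n x * exp (A (x - p)) \<le> b * exp (- 1)"
    if x0: "x0 \<in> sphere p R" for x0
  proof -
    have "isCont A (x0 - p)"
      using contA continuous_on_eq_continuous_at[OF open_UNIV] by blast
    then have "isCont (\<lambda>x. A (x - p)) x0"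
      by (intro isCont_o2[where g = A and f = "\<lambda>x. x - p"]) simp_all
    then have "\<exists>d>0. \<forall>x. dist x x0 < d \<longrightarrow> dist (A (x - p)) (A (x0 - p)) < 1 / 2"
      unfolding continuous_at_eps_delta by (elim allE[of _ "1 / 2"]) simp
    then obtain d where d: "0 < d" "\<And>x. dist x x0 < d \<Longrightarrow> dist (A (x - p)) (A (x0 - p)) < 1 / 2"
      by blast
    have dA: "\<bar>A (x - p) - A (x0 - p)\<bar> < 1 / 2" if "x \<in> ball x0 d" for x
      using d(2)[of x] that by (simp add: dist_commute[of x0 x] dist_real_def)
    have le: "f x \<le> b * exp (- 5 / 2 - A (x0 - p))" if x: "x \<in> ball x0 (min d 1)" for x
    proof -
      have "norm (x0 - p) = R" "norm (x - x0) < 1"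
        using x0 x by (simp_all add: dist_norm norm_minus_commute)
      then have "R0 \<le> norm x"
        using norm_triangle_ineq4[of x0 p] norm_triangle_ineq3[of x x0] by (simp add: R_def)
      then have "f x * exp (A (x - p)) * exp (- A (x - p)) \<le> b * exp (- 3) * exp (- A (x - p))"
        by (intro mult_right_mono far) auto
      moreover have "f x * exp (A (x - p)) * exp (- A (x - p)) = f x"
        by (simp add: exp_minus)
      moreover have "b * exp (- 3) * exp (- A (x - p)) = b * exp (- 3 - A (x - p))"
        unfolding mult.assoc exp_add[symmetric] by simp
      ultimately have "f x \<le> b * exp (- 3 - A (x - p))"
        by (simp only:)
      also have "\<dots> \<le> b * exp (- 5 / 2 - A (x0 - p))"
      proof -
        have "- 3 - A (x - p) \<le> - 5 / 2 - A (x0 - p)"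
          using dA[of x] x unfolding abs_less_iff by simp
        then show ?thesis
          using base(2) by simp
      qed
      finally show ?thesis .
    qed
    have "\<exists>r>0. \<forall>\<^sub>F n in sequentially. \<forall>x\<in>ball x0 r. fn n x \<le> b * exp (- 3 / 2 - A (x0 - p))"
      by (rule eventually_le_near[where \<delta> = "min d 1", OF base(1,2,4) _ le]) (use d(1) base(2) in auto)
    then obtain r where r: "0 < r"
      "\<forall>\<^sub>F n in sequentially. \<forall>x\<in>ball x0 r. fn n x \<le> b * exp (- 3 / 2 - A (x0 - p))"
      by blast
    have "\<forall>\<^sub>F n in sequentially. \<forall>x\<in>ball x0 (min r d) \<inter> sphere p R.
        fn n x * exp (A (x - p)) \<le> b * exp (- 1)"
      using r(2)
    proof eventually_elim
      case (elim n)
      show ?case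
      proof
        fix x assume x: "x \<in> ball x0 (min r d) \<inter> sphere p R"
        then have "fn n x * exp (A (x - p)) \<le> b * exp (- 3 / 2 - A (x0 - p)) * exp (A (x - p))"
          using elim by (intro mult_right_mono) auto
        also have "\<dots> = b * exp (- 3 / 2 - A (x0 - p) + A (x - p))"
          by (simp only: exp_add mult.assoc)
        also have "\<dots> \<le> b * exp (- 1)"
        proof -
          have "- 3 / 2 - A (x0 - p) + A (x - p) \<le> - 1"
            using dA[of x] x unfolding abs_less_iff by simp
          then show ?thesis
            using base(2) by simp
        qed
        finally show "fn n x * exp (A (x - p)) \<le> b * exp (- 1)" .
      qed
    qed
    then show ?thesis
      using r(1) d(1) by (intro exI[of _ "min r d"]) auto
  qed
  have "\<forall>\<^sub>F n in sequentially. \<forall>x\<in>sphere p R. fn n x * exp (A (x - p)) \<le> b * exp (- 1)"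
    by (rule eventually_all_compact[OF compact_sphere near])
  then have fn_out: "\<forall>\<^sub>F n in sequentially. \<forall>x. R \<le> norm (x - p) \<longrightarrow>
       fn n x * exp (A (x - p)) \<le> b * exp (- (norm (x - p) / R))"
    using base(4)
  proof eventually_elim
    case (elim n)
    show ?case
    proof (intro allI impI)
      fix x assume x: "R \<le> norm (x - p)"
      show "fn n x * exp (A (x - p)) \<le> b * exp (- (norm (x - p) / R))"
      proof (rule ray_decay[OF lc_fn A R base(2) _ _ x])
        show "b \<le> fn n p"
          using elim(2) base(1) by simp
        fix y assume "norm (y - p) = R"
        then have "y \<in> sphere p R"
          by (simp add: dist_norm norm_minus_commute)
        then show "fn n y * exp (A (y - p)) \<le> b * exp (- 1)"
          using elim(1) by blast
      qed
    qed
  qed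
  have f_out: "f x * exp (A (x - p)) \<le> b * exp (- (norm (x - p) / R))" if "R \<le> norm (x - p)" for x
  proof (rule ray_decay[OF lc_f A R base(2,3) _ that])
    fix y assume y: "norm (y - p) = R"
    then have "R0 \<le> norm y"
      using norm_triangle_ineq4[of y p] by (simp add: R_def)
    then have "f y * exp (A (y - p)) \<le> b * exp (- 3)"
      by (rule far)
    also have "\<dots> \<le> b * exp (- 1)"
      using base by (intro mult_left_mono) auto
    finally show "f y * exp (A (y - p)) \<le> b * exp (- 1)" .
  qed
  show ?thesis
    by (rule that[OF base(2) R _ fn_out]) (intro allI impI f_out)
qed

text \<open>The global bound for \<open>f\<close>, raised by 1 for a strict gap, passes to
  \<open>fn n\<close> locally and then to the whole ball by compactness.\<close>

lemma eventually_bounded_on_cball: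
  obtains M where "0 \<le> M" "\<forall>x. f x \<le> M" "\<forall>\<^sub>F n in sequentially. \<forall>x\<in>cball p R. fn n x \<le> M"
proof -
  obtain M where M: "0 \<le> M" "\<And>x. f x \<le> M"
    using log_concave_density_bounded[OF prob_P sets_P dens_f lc_f] by metis
  obtain q \<rho> b where base: "0 < \<rho>" "0 < b" "b \<le> f q"
    "\<forall>\<^sub>F n in sequentially. \<forall>y\<in>ball q \<rho>. b \<le> fn n y"
    by (rule base_ball)
  have fn_le: "\<forall>\<^sub>F n in sequentially. \<forall>x\<in>cball p R. fn n x \<le> M + 1"
  proof (rule eventually_all_compact[OF compact_cball])
    fix x0
    have "\<exists>r>0. \<forall>\<^sub>F n in sequentially. \<forall>x\<in>ball x0 r. fn n x \<le> M + 1"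
      by (rule eventually_le_near[OF base(1,2,4) zero_less_one M(2)]) simp
    then show "\<exists>r>0. \<forall>\<^sub>F n in sequentially. \<forall>x\<in>ball x0 r \<inter> cball p R. fn n x \<le> M + 1"
      by (elim ex_forward conj_forward eventually_mono) auto
  qed
  show ?thesis
  proof (rule that[OF _ _ fn_le])
    show "0 \<le> M + 1" "\<forall>x. f x \<le> M + 1"
      using M by (auto simp: add_increasing2)
  qed
qed

lemma exponential_decay:
  assumes A: "sublinear A" and lim: "((\<lambda>x. f x * exp (A x)) \<longlongrightarrow> 0) at_infinity"
  obtains K s where "0 < s" "\<forall>x. f x * exp (A x) \<le> K * exp (- s * norm x)"
    "\<forall>\<^sub>F n in sequentially. \<forall>x. fn n x * exp (A x) \<le> K * exp (- s * norm x)"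
proof -
  obtain b R p where b: "0 < b" and R: "0 < R"
    and f_out: "\<forall>x. R \<le> norm (x - p) \<longrightarrow> f x * exp (A (x - p)) \<le> b * exp (- (norm (x - p) / R))"
    and fn_out: "\<forall>\<^sub>F n in sequentially. \<forall>x. R \<le> norm (x - p) \<longrightarrow>
       fn n x * exp (A (x - p)) \<le> b * exp (- (norm (x - p) / R))"
    by (rule exponential_decay_outside_ball[OF A lim])
  obtain M where M: "0 \<le> M" "\<forall>x. f x \<le> M" "\<forall>\<^sub>F n in sequentially. \<forall>x\<in>cball p R. fn n x \<le> M"
    by (rule eventually_bounded_on_cball)
  have "compact (A ` cball p R)"
    by (intro compact_continuous_image continuous_on_subset[OF sublinear_continuous[OF A]]) auto
  from bounded_imp_bdd_above[OF compact_imp_bounded[OF this]]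
  obtain a where a: "\<And>x. x \<in> cball p R \<Longrightarrow> A x \<le> a"
    unfolding bdd_above_def by blast
  \<comment> \<open>Outside the ball, \<open>K1\<close> pays for recentring both the weight and the
    norm from \<open>p\<close> to 0. Inside, \<open>K2\<close> compensates the decay factor through
    \<open>norm x \<le> norm p + R\<close>.\<close>
  define K1 where "K1 = b * exp (A p + norm p / R)"
  define K2 where "K2 = M * exp (a + (norm p + R) / R)"
  define K where "K = max K1 K2"
  have bound: "h x * exp (A x) \<le> K * exp (- (1 / R) * norm x)"
    if h: "\<And>x. 0 \<le> h x"
      "\<And>x. R \<le> norm (x - p) \<Longrightarrow> h x * exp (A (x - p)) \<le> b * exp (- (norm (x - p) / R))"
      "\<And>x. x \<in> cball p R \<Longrightarrow> h x \<le> M" for h :: "'a \<Rightarrow> real" and x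
  proof (cases "R \<le> norm (x - p)")
    case True
    have "A ((x - p) + p) \<le> A (x - p) + A p"
      using A unfolding sublinear_def by blast
    then have "h x * exp (A x) \<le> h x * exp (A (x - p) + A p)"
      using h(1) by (intro mult_left_mono) auto
    also have "\<dots> = (h x * exp (A (x - p))) * exp (A p)"
      by (simp add: exp_add)
    also have "\<dots> \<le> (b * exp (- (norm (x - p) / R))) * exp (A p)"
      by (intro mult_right_mono h True) auto
    also have "\<dots> = b * exp (- (norm (x - p) / R) + A p)"
      by (simp only: exp_add mult.assoc)
    also have "\<dots> \<le> b * exp (A p + norm p / R + - (1 / R) * norm x)"
    proof -
      have "(norm x - norm p) / R \<le> norm (x - p) / R"
        using R norm_triangle_ineq2[of x p] by (intro divide_right_mono) auto
      then show ?thesis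
        using b by (simp add: diff_divide_distrib)
    qed
    also have "\<dots> = K1 * exp (- (1 / R) * norm x)"
      by (simp only: K1_def exp_add mult.assoc)
    also have "\<dots> \<le> K * exp (- (1 / R) * norm x)"
      by (intro mult_right_mono) (auto simp: K_def)
    finally show ?thesis .
  next
    case False
    then have x: "x \<in> cball p R"
      by (simp add: dist_norm norm_minus_commute)
    have "h x * exp (A x) \<le> M * exp a"
      by (rule mult_mono[OF h(3)[OF x] _ M(1)]) (simp_all add: a[OF x])
    also have "\<dots> \<le> M * exp (a + (norm p + R) / R + - (1 / R) * norm x)"
    proof -
      have "norm x \<le> norm p + R"
        using False norm_triangle_ineq2[of x p] by simp
      then have "norm x / R \<le> (norm p + R) / R"
        using R by (intro divide_right_mono) auto
      then have "a \<le> a + (norm p + R) / R + - (1 / R) * norm x"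
        by simp
      then show ?thesis
        using M(1) by (intro mult_left_mono) (simp_all only: exp_le_cancel_iff)
    qed
    also have "\<dots> = K2 * exp (- (1 / R) * norm x)"
      by (simp only: K2_def exp_add mult.assoc)
    also have "\<dots> \<le> K * exp (- (1 / R) * norm x)"
      by (intro mult_right_mono) (auto simp: K_def)
    finally show ?thesis .
  qed
  show ?thesis
  proof (rule that)
    show "0 < 1 / R" using R by simp
    show "\<forall>x. f x * exp (A x) \<le> K * exp (- (1 / R) * norm x)"
      by (rule allI, rule bound[OF log_concave_fun_nonneg[OF lc_f] f_out[rule_format] M(2)[rule_format]])
    show "\<forall>\<^sub>F n in sequentially. \<forall>x. fn n x * exp (A x) \<le> K * exp (- (1 / R) * norm x)"
      using fn_out M(3)
    proof eventually_elim
      case (elim n)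
      then show ?case
        by (intro allI, intro bound[OF log_concave_fun_nonneg[OF lc_fn]]) blast+
    qed
  qed
qed

section \<open>Uniform and weighted integral convergence\<close>

lemma uniform_limit_closed_isCont:
  assumes "closed S" "\<And>x. x \<in> S \<Longrightarrow> isCont f x"
  shows "uniform_limit S fn f sequentially"
  unfolding uniform_limit_iff
proof (intro allI impI)
  fix e :: real assume e: "0 < e"
  \<comment> \<open>With weight 0 the decay condition is just that \<open>f\<close> vanishes at
    infinity, so both densities are below \<open>e\<close> far out, uniformly in large
    \<open>n\<close>.\<close>
  have "sublinear (\<lambda>_::'a. 0)"
    by (simp add: sublinear_def)
  moreover have "((\<lambda>x. f x * exp 0) \<longlongrightarrow> 0) at_infinity"
    using log_concave_density_tendsto_0[OF prob_P sets_P dens_f lc_f] by simp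
  ultimately obtain K s where s: "0 < s" and fK: "\<forall>x. f x * exp 0 \<le> K * exp (- s * norm x)"
    and fnK: "\<forall>\<^sub>F n in sequentially. \<forall>x. fn n x * exp 0 \<le> K * exp (- s * norm x)"
    by (rule exponential_decay)
  have "((\<lambda>t. exp (- s * t)) \<longlongrightarrow> 0) at_top"
    using s by (intro filterlim_compose[OF exp_at_bot] filterlim_tendsto_neg_mult_at_bot[OF tendsto_const])
      (auto intro: filterlim_ident)
  then have "((\<lambda>t. K * exp (- s * t)) \<longlongrightarrow> 0) at_top"
    by (rule tendsto_mult_right_zero)
  then have "\<forall>\<^sub>F t in at_top. K * exp (- s * t) < e"
    using e by (rule order_tendstoD(2))
  then obtain T where T: "\<And>t. T \<le> t \<Longrightarrow> K * exp (- s * t) < e"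
    by (auto simp: eventually_at_top_linorder)
  have "compact (S \<inter> cball 0 T)"
    using assms(1) by (simp add: closed_Int_compact)
  then have "\<forall>\<^sub>F n in sequentially. \<forall>x\<in>S \<inter> cball 0 T. \<bar>fn n x - f x\<bar> < e"
  proof (rule eventually_all_compact)
    fix x0 assume "x0 \<in> S \<inter> cball 0 T"
    then have "isCont f x0"
      by (intro assms(2)) simp
    from eventually_near_isCont[OF this e]
    show "\<exists>r>0. \<forall>\<^sub>F n in sequentially. \<forall>x\<in>ball x0 r \<inter> (S \<inter> cball 0 T). \<bar>fn n x - f x\<bar> < e"
      by (elim ex_forward conj_forward eventually_mono) auto
  qed
  then show "\<forall>\<^sub>F n in sequentially. \<forall>x\<in>S. dist (fn n x) (f x) < e"
    using fnK
  proof eventually_elim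
    case (elim n)
    show ?case
    proof
      fix x assume x: "x \<in> S"
      show "dist (fn n x) (f x) < e"
      proof (cases "norm x \<le> T")
        case True
        then show ?thesis
          using elim x by (auto simp: dist_real_def)
      next
        case False
        then have "K * exp (- s * norm x) < e"
          by (intro T) auto
        moreover have "fn n x \<le> K * exp (- s * norm x)" "f x \<le> K * exp (- s * norm x)"
          using elim(2) fK by simp_all
        ultimately have "fn n x < e" "f x < e"
          by linarith+
        then show ?thesis
          using log_concave_fun_nonneg[OF lc_fn, of n x] log_concave_fun_nonneg[OF lc_f, of x]
          by (simp add: dist_real_def)
      qed
    qed
  qed
qed

lemma weighted_L1_convergence:
  assumes A: "sublinear A" and lim: "((\<lambda>x. f x * exp (A x)) \<longlongrightarrow> 0) at_infinity"
  shows "(\<integral>\<^sup>+x. ennreal (exp (A x) * f x) \<partial>lebesgue) < \<infinity>"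
    and "(\<lambda>n. \<integral>\<^sup>+x. ennreal (exp (A x) * \<bar>fn n x - f x\<bar>) \<partial>lebesgue) \<longlonglongrightarrow> 0"
proof -
  obtain K s where s: "0 < s" and fK: "\<forall>x. f x * exp (A x) \<le> K * exp (- s * norm x)"
    and fnK: "\<forall>\<^sub>F n in sequentially. \<forall>x. fn n x * exp (A x) \<le> K * exp (- s * norm x)"
    by (rule exponential_decay[OF A lim])
  have [measurable]: "f \<in> borel_measurable lebesgue" "\<And>n. fn n \<in> borel_measurable lebesgue"
    using dens_f dens_fn by (auto simp: lebesgue_density_def)
  have [measurable]: "A \<in> borel_measurable lebesgue"
    using borel_measurable_continuous_onI[OF sublinear_continuous[OF A]] by (simp add: measurable_completion)
  have [measurable]: "(norm :: 'a \<Rightarrow> real) \<in> borel_measurable lebesgue"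
    by (intro measurable_completion) simp
  let ?w = "\<lambda>x::'a. K * exp (- s * norm x)"
  have w: "(\<integral>\<^sup>+x. ennreal (?w x) \<partial>lebesgue) < \<infinity>"
  proof -
    \<comment> \<open>The constant must be nonnegative to be pulled out of the
      \<open>ennreal\<close> integral; the bound at the origin forces this.\<close>
    have "0 \<le> K"
    proof -
      have "0 \<le> f 0 * exp (A 0)"
        using log_concave_fun_nonneg[OF lc_f] by simp
      also have "\<dots> \<le> K"
        using fK[rule_format, of 0] by simp
      finally show ?thesis .
    qed
    then have "(\<integral>\<^sup>+x. ennreal (?w x) \<partial>lebesgue) = ennreal K * (\<integral>\<^sup>+x. ennreal (exp (- s * norm (x::'a))) \<partial>lebesgue)"
      by (subst nn_integral_cmult[symmetric]) (simp_all add: ennreal_mult)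
    also have "\<dots> < \<infinity>"
      using nn_integral_exp_norm_finite[OF s, where 'a = 'a] by (simp add: ennreal_mult_less_top)
    finally show ?thesis .
  qed
  have "(\<integral>\<^sup>+x. ennreal (exp (A x) * f x) \<partial>lebesgue) \<le> (\<integral>\<^sup>+x. ennreal (?w x) \<partial>lebesgue)"
    by (intro nn_integral_mono ennreal_leI) (subst mult.commute, rule fK[rule_format])
  then show "(\<integral>\<^sup>+x. ennreal (exp (A x) * f x) \<partial>lebesgue) < \<infinity>"
    using w by (rule le_less_trans)
  \<comment> \<open>Domination holds only from some index on, so dominated convergence is applied to
    the sequence shifted by \<open>N\<close>; the shift is undone at the end.\<close>
  obtain N where N: "\<And>n x. N \<le> n \<Longrightarrow> fn n x * exp (A x) \<le> ?w x"
    using fnK unfolding eventually_sequentially by blast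
  have "(\<lambda>n. \<integral>\<^sup>+x. norm (exp (A x) * f x - exp (A x) * fn (n + N) x) \<partial>lebesgue) \<longlonglongrightarrow> 0"
  proof (rule nn_integral_dominated_convergence_norm[where w = ?w])
    show "AE x in lebesgue. norm (exp (A x) * fn (n + N) x) \<le> ?w x" for n
    proof (rule AE_I2)
      fix x
      have "norm (exp (A x) * fn (n + N) x) = fn (n + N) x * exp (A x)"
        using log_concave_fun_nonneg[OF lc_fn, of "n + N" x] by (simp add: abs_mult)
      also have "\<dots> \<le> ?w x"
        by (rule N) simp
      finally show "norm (exp (A x) * fn (n + N) x) \<le> ?w x" .
    qed
    show "AE x in lebesgue. (\<lambda>n. exp (A x) * fn (n + N) x) \<longlonglongrightarrow> exp (A x) * f x"
      using AE_isCont[OF lc_f]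
      by eventually_elim (intro tendsto_mult_left LIMSEQ_ignore_initial_segment tendsto_at_isCont)
  qed (use w in \<open>measurable\<close>)
  also have "(\<lambda>n. \<integral>\<^sup>+x. norm (exp (A x) * f x - exp (A x) * fn (n + N) x) \<partial>lebesgue)
      = (\<lambda>n. \<integral>\<^sup>+x. ennreal (exp (A x) * \<bar>fn (n + N) x - f x\<bar>) \<partial>lebesgue)"
    by (simp only: right_diff_distrib[symmetric] real_norm_def abs_mult abs_exp_cancel
        abs_minus_commute[of "f _"])
  finally show "(\<lambda>n. \<integral>\<^sup>+x. ennreal (exp (A x) * \<bar>fn n x - f x\<bar>) \<partial>lebesgue) \<longlonglongrightarrow> 0"
    by (rule LIMSEQ_offset)
qed

end

theorem theorem2p1:
  fixes P :: "(real ^ 'd) measure" and Pn :: "nat \<Rightarrow> (real ^ 'd) measure"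
    and f :: "real ^ 'd \<Rightarrow> real" and fn :: "nat \<Rightarrow> real ^ 'd \<Rightarrow> real"
  assumes "P \<in> lc_distributions" and "\<And>n. Pn n \<in> lc_distributions"
    and "lc_density P f" and "\<And>n. lc_density (Pn n) (fn n)"
    and "weakly_converges Pn P"
  shows "(\<forall>S. closed S \<longrightarrow> (\<forall>x\<in>S. isCont f x) \<longrightarrow> uniform_limit S fn f sequentially) \<and>
    (\<forall>A :: real ^ 'd \<Rightarrow> real. sublinear A \<longrightarrow>
       ((\<lambda>x. f x * exp (A x)) \<longlongrightarrow> 0) at_infinity \<longrightarrow>
       (\<integral>\<^sup>+x. ennreal (exp (A x) * f x) \<partial>lebesgue) < \<infinity> \<and>
       (\<lambda>n. \<integral>\<^sup>+x. ennreal (exp (A x) * \<bar>fn n x - f x\<bar>) \<partial>lebesgue) \<longlonglongrightarrow> 0)"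
proof -
  interpret lc_limit P Pn f fn
    using assms by unfold_locales
  show ?thesis
  proof (intro conjI allI impI)
    show "uniform_limit S fn f sequentially" if "closed S" "\<forall>x\<in>S. isCont f x" for S
      using that by (intro uniform_limit_closed_isCont) auto
  qed (rule weighted_L1_convergence; assumption)+
qed

end
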